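(* Let $d\ge1$, let $T$ be a continuous $T$-norm, and let $X$ be a set of $d+2$ points in $[0,1]^d$. Then there are two disjoint subsets $X^1$ and $X^2$ of $X$ whose max-T convex hulls have a common point.
   Context: A $T$-norm is a function $T:[0,1]^2\to[0,1]$ such that for all $x,y,z\in[0,1]$: $T(x,T(y,z))=T(T(x,y),z)$; $T(x,y)\le T(x,z)$ and $T(y,x)\le T(z,x)$ whenever $y\le z$; $T(x,1)=T(1,x)=x$. It is continuous if $\lim_n T(x_n,y_n)=T(\lim_n x_n,\lim_n y_n)$ for all convergent sequences $(x_n),(y_n)$ in $[0,1]$. Put $a\oplus b=\max(a,b)$ and $a\otimes_T b=T(a,b)$; $\oplus$ acts on vectors of $[0,1]^d$ componentwise and $(\lambda\otimes_T x)_k=T(\lambda,x_k)$. A set $C\subseteq[0,1]^d$ is max-T convex if for all $x,y\in C$ and $\lambda,\mu\in[0,1]$ with $\lambda\oplus\mu=1$ one has $\lambda\otimes_T x\oplus\mu\otimes_T y\in C$. The max-T convex hull of $X\subseteq[0,1]^d$ is the smallest max-T convex set containing $X$; equivalently, the set of all $\bigoplus_{i=1}^m\lambda_i\otimes_T x^i$ with $m\ge1$, $x^i\in X$, $\bigoplus_{i=1}^m\lambda_i=1$. *)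

theory Defs
  imports "HOL-Analysis.Analysis"
begin

definition t_norm :: "(real \<Rightarrow> real \<Rightarrow> real) \<Rightarrow> bool" where
  "t_norm T \<longleftrightarrow>
     (\<forall>x\<in>{0..1}. \<forall>y\<in>{0..1}. T x y \<in> {0..1}) \<and>
     (\<forall>x\<in>{0..1}. \<forall>y\<in>{0..1}. \<forall>z\<in>{0..1}. T x (T y z) = T (T x y) z) \<and>
     (\<forall>x\<in>{0..1}. \<forall>y\<in>{0..1}. \<forall>z\<in>{0..1}. y \<le> z \<longrightarrow> T x y \<le> T x z \<and> T y x \<le> T z x) \<and>
     (\<forall>x\<in>{0..1}. T x 1 = x \<and> T 1 x = x)"

definition continuous_t_norm :: "(real \<Rightarrow> real \<Rightarrow> real) \<Rightarrow> bool" where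
  "continuous_t_norm T \<longleftrightarrow> t_norm T \<and>
     (\<forall>(x :: nat \<Rightarrow> real) y a b.
        (\<forall>n. x n \<in> {0..1}) \<longrightarrow> (\<forall>n. y n \<in> {0..1}) \<longrightarrow> x \<longlonglongrightarrow> a \<longrightarrow> y \<longlonglongrightarrow> b \<longrightarrow>
        (\<lambda>n. T (x n) (y n)) \<longlonglongrightarrow> T a b)"

definition unit_cube :: "(real ^ 'd) set" where
  "unit_cube = {x. \<forall>k. x $ k \<in> {0..1}}"

definition vmax :: "real ^ 'd \<Rightarrow> real ^ 'd \<Rightarrow> real ^ 'd" where
  "vmax x y = (\<chi> k. max (x $ k) (y $ k))"

definition t_scale :: "(real \<Rightarrow> real \<Rightarrow> real) \<Rightarrow> real \<Rightarrow> real ^ 'd \<Rightarrow> real ^ 'd" where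
  "t_scale T c x = (\<chi> k. T c (x $ k))"

definition max_T_convex :: "(real \<Rightarrow> real \<Rightarrow> real) \<Rightarrow> (real ^ 'd) set \<Rightarrow> bool" where
  "max_T_convex T C \<longleftrightarrow> C \<subseteq> unit_cube \<and>
     (\<forall>x\<in>C. \<forall>y\<in>C. \<forall>l\<in>{0..1}. \<forall>m\<in>{0..1}.
        max l m = 1 \<longrightarrow> vmax (t_scale T l x) (t_scale T m y) \<in> C)"

definition max_T_hull :: "(real \<Rightarrow> real \<Rightarrow> real) \<Rightarrow> (real ^ 'd) set \<Rightarrow> (real ^ 'd) set" where
  "max_T_hull T X = max_T_convex T hull X"

lemma max_T_convex_unit_cube:
  assumes "t_norm T"
  shows "max_T_convex T unit_cube"
  using assms unfolding max_T_convex_def unit_cube_def vmax_def t_scale_def t_norm_def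
  by (auto simp: max_def)

text \<open>For \<open>X\<close> inside the unit cube the intersection taken by \<^const>\<open>hull\<close> is over a nonempty
  family, so it really is the smallest max-T convex set containing \<open>X\<close>.\<close>

lemma max_T_convex_max_T_hull:
  assumes "t_norm T" and "X \<subseteq> unit_cube"
  shows "max_T_convex T (max_T_hull T X)"
proof -
  have "max_T_hull T X \<subseteq> unit_cube"
    unfolding max_T_hull_def
    using assms max_T_convex_unit_cube by (metis hull_minimal)
  then show ?thesis
    unfolding max_T_convex_def[of T "max_T_hull T X"]
    by (auto simp: max_T_hull_def hull_def max_T_convex_def)
qed

lemma max_T_hull_superset: "X \<subseteq> max_T_hull T X"
  by (simp add: max_T_hull_def hull_subset)

lemma max_T_hull_least: "max_T_convex T C \<Longrightarrow> X \<subseteq> C \<Longrightarrow> max_T_hull T X \<subseteq> C"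
  by (simp add: max_T_hull_def hull_minimal)

end

theory Submission
  imports Defs
begin

text \<open>Index the points by the \<open>d + 2\<close> columns and the coordinates, together with an extra coordinate
  constantly 1, by the \<open>d + 1\<close> rows of a matrix; equal maxima in the extra row force
  both sides of a partition to have maximal coefficient 1. For each row, weights concentrated on
  the columns almost attaining the row maximum give a self-map of the standard simplex preserving
  its faces, and so does the average over the rows. By Brouwer's theorem this average hits the
  barycentre, and double counting shows that any set of rows uses more columns than it has rows.
  Such a hypergraph has a 2-colouring of the columns in which every row is bichromatic, so for
  every row the maxima over the two colours almost agree. Compactness makes them equal.\<close>

section \<open>Linear systems and two-colourings of hypergraphs\<close>

text \<open>Gaussian elimination: an equation with a nonzero coefficient removes one unknown along
  with itself, so the surplus of unknowns survives. An equation that vanishes on \<open>V\<close> is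
  simply dropped.\<close>

lemma homogeneous_system_nontrivial_solution:
  fixes A :: "'r \<Rightarrow> 'c \<Rightarrow> 'a :: field"
  assumes "finite R" "finite V" "card R < card V"
  shows "\<exists>y. (\<exists>i\<in>V. y i \<noteq> 0) \<and> (\<forall>k\<in>R. (\<Sum>i\<in>V. A k i * y i) = 0)"
  using assms
proof (induction R arbitrary: V A rule: finite_induct)
  case empty
  then obtain i where "i \<in> V" by fastforce
  then show ?case by (intro exI[of _ "\<lambda>_. 1"]) auto
next
  case (insert k R)
  show ?case
  proof (cases "\<forall>i\<in>V. A k i = 0")
    case True
    obtain y where "\<exists>i\<in>V. y i \<noteq> 0" "\<forall>l\<in>R. (\<Sum>i\<in>V. A l i * y i) = 0"
      using insert.IH[of V A] insert.prems insert.hyps by auto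
    with True show ?thesis by (intro exI[of _ y]) auto
  next
    case False
    then obtain j where j: "j \<in> V" "A k j \<noteq> 0" by blast
    let ?W = "V - {j}"
    have "card R < card ?W" using insert j by simp
    then obtain y where y: "\<exists>i\<in>?W. y i \<noteq> 0"
      and y0: "\<And>l. l \<in> R \<Longrightarrow> (\<Sum>i\<in>?W. (A l i - A l j * A k i / A k j) * y i) = 0"
      using insert.IH[of ?W "\<lambda>l i. A l i - A l j * A k i / A k j"] insert.prems by auto
    define s where "s = (\<Sum>i\<in>?W. A k i * y i)"
    \<comment> \<open>The value at \<open>j\<close> is chosen so that equation \<open>k\<close>
      holds; the other equations then reduce to the eliminated system.\<close>
    define z where "z = y(j := - s / A k j)"
    have z: "(\<Sum>i\<in>V. A l i * z i) = (\<Sum>i\<in>?W. A l i * y i) - A l j * s / A k j" for l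
    proof -
      have "(\<Sum>i\<in>V. A l i * z i) = A l j * z j + (\<Sum>i\<in>?W. A l i * z i)"
        using insert.prems j by (simp add: sum.remove)
      also have "(\<Sum>i\<in>?W. A l i * z i) = (\<Sum>i\<in>?W. A l i * y i)"
        by (rule sum.cong) (auto simp: z_def)
      finally show ?thesis by (simp add: z_def)
    qed
    have "(\<Sum>i\<in>V. A l i * z i) = 0" if "l \<in> R" for l
    proof -
      have "(\<Sum>i\<in>?W. (A l i - A l j * A k i / A k j) * y i)
          = (\<Sum>i\<in>?W. A l i * y i) - A l j / A k j * s"
        by (simp add: s_def sum_distrib_left sum_subtractf[symmetric] algebra_simps)
      with y0[OF that] show ?thesis unfolding z by simp
    qed
    moreover have "(\<Sum>i\<in>V. A k i * z i) = 0"
      unfolding z using j by (simp add: s_def)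
    moreover have "\<exists>i\<in>V. z i \<noteq> 0" using y by (auto simp: z_def)
    ultimately show ?thesis by (intro exI[of _ z]) auto
  qed
qed

text \<open>Seymour's argument: a nontrivial kernel vector of the incidence matrix takes both signs on
  every edge on which it does not vanish, and the remaining edges live on its smaller zero set.\<close>

lemma two_colouring_if_deficiency:
  fixes N :: "'r \<Rightarrow> 'c set"
  assumes "finite V" "finite R" "\<And>k. k \<in> R \<Longrightarrow> N k \<subseteq> V"
    and "\<And>S. S \<subseteq> R \<Longrightarrow> S \<noteq> {} \<Longrightarrow> card S < card (\<Union>k\<in>S. N k)"
  shows "\<exists>P. \<forall>k\<in>R. N k \<inter> P \<noteq> {} \<and> N k - P \<noteq> {}"
  using assms
proof (induction V arbitrary: R rule: finite_psubset_induct)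
  case (psubset V)
  show ?case
  proof (cases "R = {}")
    case False
    have "card (\<Union>k\<in>R. N k) \<le> card V"
      using psubset.prems(2) psubset.hyps by (intro card_mono UN_least)
    \<comment> \<open>Deficiency for \<open>S = R\<close>: the incidence system has fewer equations
      than unknowns.\<close>
    then have "card R < card V"
      using psubset.prems(3)[of R] False by simp
    then obtain y where y: "\<exists>i\<in>V. y i \<noteq> (0 :: real)"
      and y0: "\<And>k. k \<in> R \<Longrightarrow> (\<Sum>i\<in>V. (if i \<in> N k then 1 else 0) * y i) = 0"
      using homogeneous_system_nontrivial_solution[OF psubset.prems(1) psubset.hyps,
          of "\<lambda>k i. if i \<in> N k then 1 else 0"] by auto
    have sum0: "(\<Sum>i\<in>N k. y i) = 0" if "k \<in> R" for k
    proof -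
      have "(\<Sum>i\<in>V. (if i \<in> N k then 1 else 0) * y i) = (\<Sum>i\<in>V. if i \<in> N k then y i else 0)"
        by (rule sum.cong) auto
      also have "\<dots> = (\<Sum>i\<in>V \<inter> N k. y i)"
        using psubset.hyps by (simp add: sum.inter_restrict)
      also have "V \<inter> N k = N k" using psubset.prems(2)[OF that] by auto
      finally show ?thesis using y0[OF that] by simp
    qed
    define Z where "Z = {i\<in>V. y i = 0}"
    define Q where "Q = {k\<in>R. N k \<subseteq> Z}"
    have "Z \<subset> V" using y by (auto simp: Z_def)
    moreover have "finite Q" using psubset.prems(1) by (simp add: Q_def)
    moreover have "card S < card (\<Union>k\<in>S. N k)" if "S \<subseteq> Q" "S \<noteq> {}" for S
      using that by (intro psubset.prems(3)) (auto simp: Q_def)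
    moreover have "N k \<subseteq> Z" if "k \<in> Q" for k using that by (simp add: Q_def)
    ultimately have "\<exists>P. \<forall>k\<in>Q. N k \<inter> P \<noteq> {} \<and> N k - P \<noteq> {}" by (intro psubset.IH)
    then obtain P where P: "\<And>k. k \<in> Q \<Longrightarrow> N k \<inter> P \<noteq> {} \<and> N k - P \<noteq> {}" by blast
    \<comment> \<open>Off \<open>Z\<close> the sign of \<open>y\<close> decides the colour; on
      \<open>Z\<close>, where \<open>y\<close> vanishes, the colouring from the induction does. So
      \<open>P'\<close> agrees with \<open>P\<close> on the edges in \<open>Q\<close>.\<close>
    define P' where "P' = (P \<inter> Z) \<union> {i\<in>V. y i > 0}"
    have "N k \<inter> P' \<noteq> {} \<and> N k - P' \<noteq> {}" if k: "k \<in> R" for k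
    proof (cases "k \<in> Q")
      case True
      then have "N k \<subseteq> Z" by (simp add: Q_def)
      then have "N k \<inter> P' = N k \<inter> P" by (auto simp: P'_def Z_def)
      then show ?thesis using P[OF True] by blast
    next
      case False
      then obtain i where i: "i \<in> N k" "y i \<noteq> 0"
        using k psubset.prems(2)[OF k] by (auto simp: Q_def Z_def)
      have fin: "finite (N k)" using psubset.prems(2)[OF that] psubset.hyps finite_subset by blast
      have "\<exists>i\<in>N k. y i > 0"
      proof (rule ccontr)
        assume "\<not> ?thesis"
        then have "\<forall>i\<in>N k. - y i \<ge> 0" by force
        then have "\<forall>i\<in>N k. - y i = 0"
          using sum_nonneg_eq_0_iff[OF fin, of "\<lambda>i. - y i"] sum0[OF that]
          by (simp add: sum_negf)
        with i show False by auto
      qed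
      moreover have "\<exists>i\<in>N k. y i < 0"
      proof (rule ccontr)
        assume "\<not> ?thesis"
        then have "\<forall>i\<in>N k. y i \<ge> 0" by force
        then have "\<forall>i\<in>N k. y i = 0"
          using sum_nonneg_eq_0_iff[OF fin, of y] sum0[OF that] by simp
        with i show False by auto
      qed
      ultimately obtain i j where "i \<in> N k" "y i > 0" "j \<in> N k" "y j < 0" by blast
      then have "i \<in> N k \<inter> P'" "j \<in> N k - P'"
        using psubset.prems(2)[OF that] by (auto simp: P'_def Z_def)
      then show ?thesis by blast
    qed
    then show ?thesis by blast
  qed auto
qed

section \<open>The standard simplex and Brouwer's theorem\<close>

definition std_simplex :: "(real ^ 'c) set" where
  "std_simplex = {p. (\<forall>i. 0 \<le> p $ i) \<and> (\<Sum>i\<in>UNIV. p $ i) = 1}"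

lemma convex_std_simplex: "convex std_simplex"
  unfolding convex_alt std_simplex_def
  by (auto simp: sum.distrib sum_distrib_left[symmetric])

lemma std_simplex_le_1: "p \<in> std_simplex \<Longrightarrow> p $ i \<le> 1"
  unfolding std_simplex_def using member_le_sum[of i UNIV "\<lambda>i. p $ i"] by auto

lemma compact_std_simplex: "compact (std_simplex :: (real ^ 'c) set)"
proof -
  have "std_simplex \<subseteq> cbox (0 :: real ^ 'c) 1"
    by (auto simp: mem_box_cart std_simplex_le_1) (auto simp: std_simplex_def)
  then have "bounded (std_simplex :: (real ^ 'c) set)"
    using bounded_subset bounded_cbox by blast
  moreover have "closed (std_simplex :: (real ^ 'c) set)"
    unfolding std_simplex_def
    by (intro closed_Collect_conj closed_Collect_all closed_Collect_le closed_Collect_eq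
        continuous_intros)
  ultimately show ?thesis by (simp add: compact_eq_bounded_closed)
qed

text \<open>Brouwer's theorem is applied to the map that pushes \<open>p\<close> towards the coordinates where
  \<open>f p\<close> falls short of \<open>b\<close>.\<close>

lemma face_preserving_onto_interior:
  fixes f :: "real ^ 'c \<Rightarrow> real ^ 'c"
  assumes cont: "continuous_on std_simplex f"
    and into: "\<And>p. p \<in> std_simplex \<Longrightarrow> f p \<in> std_simplex"
    and face: "\<And>p i. p \<in> std_simplex \<Longrightarrow> p $ i = 0 \<Longrightarrow> f p $ i = 0"
    and b: "b \<in> std_simplex" "\<And>i. b $ i > 0"
  shows "\<exists>p\<in>std_simplex. f p = b"
proof -
  define m where "m p i = max 0 (b $ i - f p $ i)" for p i
  define s where "s p = (\<Sum>i\<in>UNIV. m p i)" for p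
  define G where "G p = (\<chi> i. (p $ i + m p i) / (1 + s p))" for p
  have m0: "m p i \<ge> 0" for p i by (simp add: m_def)
  have s0: "s p \<ge> 0" for p by (simp add: s_def sum_nonneg m0)
  have contm: "continuous_on std_simplex (\<lambda>p. m p i)" for i
    unfolding m_def by (intro continuous_intros cont)
  have "1 + s p \<noteq> 0" for p using s0[of p] by linarith
  then have "continuous_on std_simplex G"
    unfolding G_def s_def
    by (intro continuous_intros contm) (auto simp: s_def)
  moreover have "G p \<in> std_simplex" if "p \<in> std_simplex" for p
  proof -
    have "(\<Sum>i\<in>UNIV. G p $ i) = (\<Sum>i\<in>UNIV. p $ i + m p i) / (1 + s p)"
      by (simp add: G_def sum_divide_distrib)
    also have "\<dots> = 1"
      using that s0[of p] by (simp add: sum.distrib s_def[symmetric] std_simplex_def)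
    finally show ?thesis
      using that m0 s0[of p] by (auto simp: std_simplex_def G_def)
  qed
  ultimately obtain p where p: "p \<in> std_simplex" "G p = p"
    using brouwer[of std_simplex G] compact_std_simplex convex_std_simplex b(1) by blast
  \<comment> \<open>Clearing the denominator in \<open>G p = p\<close>: each shortfall is
    proportional to the coordinate of \<open>p\<close> itself.\<close>
  have fix_eq: "p $ i * s p = m p i" for i
  proof -
    have "p $ i = (p $ i + m p i) / (1 + s p)"
      by (metis G_def p(2) vec_lambda_beta)
    then show ?thesis using s0[of p] by (simp add: field_simps)
  qed
  \<comment> \<open>Were \<open>s p\<close> nonzero, \<open>f p\<close> would lie strictly below
    \<open>b\<close> everywhere: by \<open>face\<close> where \<open>p\<close> vanishes, by a
    positive shortfall elsewhere. But both vectors sum to 1.\<close>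
  have "s p = 0"
  proof (rule ccontr)
    assume "s p \<noteq> 0"
    have "f p $ i < b $ i" for i
    proof (cases "p $ i = 0")
      case True
      then show ?thesis using face[OF p(1) True] b(2)[of i] by simp
    next
      case False
      then have "m p i > 0"
        using fix_eq[of i] \<open>s p \<noteq> 0\<close> m0[of p i] by (metis less_eq_real_def mult_eq_0_iff)
      then show ?thesis by (simp add: m_def split: if_splits)
    qed
    then have "(\<Sum>i\<in>UNIV. f p $ i) < (\<Sum>i\<in>UNIV. b $ i)"
      by (intro sum_strict_mono) auto
    then show False using into[OF p(1)] b(1) by (simp add: std_simplex_def)
  qed
  then have ge: "b $ i \<le> f p $ i" for i using fix_eq[of i] by (simp add: m_def)
  have "(\<Sum>i\<in>UNIV. f p $ i - b $ i) = 0"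
    using into[OF p(1)] b(1) by (simp add: sum_subtractf std_simplex_def)
  then have "\<forall>i. f p $ i - b $ i = 0"
    using sum_nonneg_eq_0_iff[of UNIV "\<lambda>i. f p $ i - b $ i"] ge by simp
  then have "f p = b" by (simp add: vec_eq_iff)
  then show ?thesis using p(1) by blast
qed

lemma continuous_on_Max_image:
  fixes f :: "'i \<Rightarrow> 'a :: topological_space \<Rightarrow> 'b :: linorder_topology"
  assumes "finite I" "I \<noteq> {}" "\<And>i. i \<in> I \<Longrightarrow> continuous_on A (f i)"
  shows "continuous_on A (\<lambda>x. Max ((\<lambda>i. f i x) ` I))"
  using assms
proof (induction I rule: finite_ne_induct)
  case (insert i I)
  have "continuous_on A (\<lambda>x. max (f i x) (Max ((\<lambda>i. f i x) ` I)))"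
    using insert by (intro continuous_on_max) auto
  then show ?case using insert by simp
qed simp

text \<open>A point hitting the barycentre makes every column of the weight matrix sum to less than 1
  while every row sums to 1, so any set of rows has more columns in its support than rows.\<close>

lemma face_preserving_maps_support_deficiency:
  fixes w :: "'r::finite \<Rightarrow> real ^ 'c \<Rightarrow> real ^ 'c"
  assumes card: "CARD('r) < CARD('c)"
    and cont: "\<And>k. continuous_on std_simplex (w k)"
    and into: "\<And>k p. p \<in> std_simplex \<Longrightarrow> w k p \<in> std_simplex"
    and face: "\<And>k p i. p \<in> std_simplex \<Longrightarrow> p $ i = 0 \<Longrightarrow> w k p $ i = 0"
  shows "\<exists>p\<in>std_simplex. \<forall>S. S \<noteq> {} \<longrightarrow> card S < card (\<Union>k\<in>S. {i. w k p $ i \<noteq> 0})"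
proof -
  let ?n = "real CARD('r)" and ?c = "real CARD('c)"
  define f where "f p = (\<chi> i. (\<Sum>k\<in>UNIV. w k p $ i) / ?n)" for p
  define b :: "real ^ 'c" where "b = (\<chi> i. 1 / ?c)"
  have "continuous_on std_simplex f"
    unfolding f_def by (intro continuous_intros cont) auto
  moreover have "f p \<in> std_simplex" if "p \<in> std_simplex" for p
  proof -
    have "(\<Sum>i\<in>UNIV. f p $ i) = (\<Sum>k\<in>UNIV. \<Sum>i\<in>UNIV. w k p $ i) / ?n"
      unfolding f_def by (subst sum.swap) (simp add: sum_divide_distrib)
    also have "\<dots> = 1" using into[OF that] by (simp add: std_simplex_def)
    finally show ?thesis
      using into[OF that] by (auto simp: std_simplex_def f_def intro!: sum_nonneg divide_nonneg_nonneg)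
  qed
  moreover have "f p $ i = 0" if "p \<in> std_simplex" "p $ i = 0" for p i
    using face[OF that] by (simp add: f_def)
  moreover have "b \<in> std_simplex" "\<And>i. b $ i > 0"
    by (auto simp: b_def std_simplex_def)
  ultimately obtain p where p: "p \<in> std_simplex" "f p = b"
    using face_preserving_onto_interior[of f b] by blast
  \<comment> \<open>All columns have the same sum, which is below 1 because there are fewer rows
    than columns.\<close>
  have col: "(\<Sum>k\<in>UNIV. w k p $ i) = ?n / ?c" for i
  proof -
    have "(\<Sum>k\<in>UNIV. w k p $ i) / ?n = 1 / ?c"
      using p(2) by (simp add: f_def b_def vec_eq_iff)
    then show ?thesis by (simp add: field_simps)
  qed
  have nn: "w k p $ i \<ge> 0" for k i using into[OF p(1), of k] by (simp add: std_simplex_def)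
  have "card S < card (\<Union>k\<in>S. {i. w k p $ i \<noteq> 0})" if "S \<noteq> {}" for S
  proof -
    define U where "U = (\<Union>k\<in>S. {i. w k p $ i \<noteq> 0})"
    have row: "(\<Sum>i\<in>U. w k p $ i) = 1" if "k \<in> S" for k
    proof -
      have "(\<Sum>i\<in>U. w k p $ i) = (\<Sum>i\<in>UNIV. w k p $ i)"
        using that by (intro sum.mono_neutral_left) (auto simp: U_def)
      then show ?thesis using into[OF p(1), of k] by (simp add: std_simplex_def)
    qed
    have "real (card S) = (\<Sum>k\<in>S. \<Sum>i\<in>U. w k p $ i)" by (simp add: row)
    also have "\<dots> = (\<Sum>i\<in>U. \<Sum>k\<in>S. w k p $ i)" by (rule sum.swap)
    also have "\<dots> \<le> (\<Sum>i\<in>U. \<Sum>k\<in>UNIV. w k p $ i)"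
      by (intro sum_mono sum_mono2) (auto simp: nn)
    also have "\<dots> = card U * (?n / ?c)" by (simp add: col)
    finally have *: "real (card S) \<le> card U * (?n / ?c)" .
    \<comment> \<open>The estimate itself rules out an empty \<open>U\<close>, for which the strict
      inequality below would fail.\<close>
    have "card S > 0" using that by (simp add: card_gt_0_iff)
    then have "card U > 0" using * by (cases "card U") auto
    then have "card U * (?n / ?c) < real (card U) * 1"
      using card by (intro mult_strict_left_mono) auto
    with * show ?thesis by (simp add: U_def)
  qed
  with p(1) show ?thesis by blast
qed


section \<open>Balancing the row maxima over two colours\<close>

text \<open>The tolerance \<open>\<epsilon>\<close> keeps the weights continuous: the set of exact
  maximisers may jump with \<open>p\<close>, while a cut-off of width \<open>\<epsilon>\<close>
  below the row maximum varies continuously. If both colours meet the support of every row, both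
  maxima lie in that window.\<close>

lemma approx_bichromatic_maxima:
  fixes h :: "'r::finite \<Rightarrow> 'c::finite \<Rightarrow> real ^ 'c \<Rightarrow> real"
  assumes card: "CARD('r) < CARD('c)"
    and cont: "\<And>k i. continuous_on std_simplex (h k i)"
    and nonneg: "\<And>k i p. p \<in> std_simplex \<Longrightarrow> 0 \<le> h k i p"
    and zero: "\<And>k i p. p \<in> std_simplex \<Longrightarrow> p $ i = 0 \<Longrightarrow> h k i p = 0"
    and "\<epsilon> > 0"
  shows "\<exists>p\<in>std_simplex. \<exists>P. P \<noteq> {} \<and> - P \<noteq> {} \<and>
    (\<forall>k. \<bar>Max ((\<lambda>i. h k i p) ` P) - Max ((\<lambda>i. h k i p) ` (- P))\<bar> < \<epsilon>)"
proof -
  define M where "M k p = Max ((\<lambda>i. h k i p) ` UNIV)" for k p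
  \<comment> \<open>The factor \<open>p $ i\<close> makes the weights vanish on the faces; the other
    factor is positive exactly for columns less than \<open>\<epsilon>\<close> below the row
    maximum.\<close>
  define u where "u k i p = p $ i * max 0 (h k i p - M k p + \<epsilon>)" for k i p
  define s where "s k p = (\<Sum>i\<in>UNIV. u k i p)" for k p
  define w where "w k p = (\<chi> i. u k i p / s k p)" for k p
  have ge: "h k i p \<le> M k p" for k i p by (simp add: M_def)
  have contu: "continuous_on std_simplex (u k i)" for k i
    unfolding u_def M_def by (intro continuous_intros continuous_on_Max_image cont) auto
  have u0: "u k i p \<ge> 0" if "p \<in> std_simplex" for k i p
    using that by (simp add: u_def std_simplex_def)
  have s0: "s k p > 0" if p: "p \<in> std_simplex" for k p
  proof -
    \<comment> \<open>A nonzero maximum is not attained where \<open>p $ i = 0\<close>, by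
      \<open>zero\<close>; if the maximum is 0, every column attains it, by
      \<open>nonneg\<close>.\<close>
    have "\<exists>i. p $ i > 0 \<and> h k i p = M k p"
    proof (cases "M k p = 0")
      case True
      have "\<exists>i. p $ i \<noteq> 0"
      proof (rule ccontr)
        assume "\<not> ?thesis"
        then show False using p by (simp add: std_simplex_def)
      qed
      then obtain i where "p $ i > 0" using p unfolding std_simplex_def
        by (metis (mono_tags, lifting) less_eq_real_def mem_Collect_eq)
      moreover have "h k i p = M k p" using nonneg[OF p, of k i] ge[of k i p] True by simp
      ultimately show ?thesis by blast
    next
      case False
      have "M k p \<in> (\<lambda>i. h k i p) ` UNIV" unfolding M_def by (intro Max_in) auto
      then obtain i where i: "h k i p = M k p" by auto
      with False zero[OF p, of i k] have "p $ i \<noteq> 0" by auto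
      moreover have "p $ i \<ge> 0" using p by (simp add: std_simplex_def)
      ultimately show ?thesis using i by (intro exI[of _ i]) auto
    qed
    then obtain i where "p $ i > 0" "h k i p = M k p" by blast
    then have "u k i p > 0" using \<open>\<epsilon> > 0\<close> by (simp add: u_def)
    then show ?thesis unfolding s_def using u0[OF p] by (intro sum_pos2[of _ i]) auto
  qed
  have "continuous_on std_simplex (w k)" for k
    unfolding w_def s_def
    by (intro continuous_intros contu) (metis s0 s_def less_irrefl)
  moreover have "w k p \<in> std_simplex" if "p \<in> std_simplex" for k p
    using that u0 s0[OF that, of k]
    by (auto simp: std_simplex_def w_def sum_divide_distrib[symmetric] s_def[symmetric]
        intro!: divide_nonneg_pos)
  moreover have "w k p $ i = 0" if "p $ i = 0" for k p i
    using that by (simp add: w_def u_def)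
  ultimately obtain p where p: "p \<in> std_simplex"
    and *: "\<And>S. S \<noteq> {} \<Longrightarrow> card S < card (\<Union>k\<in>S. {i. w k p $ i \<noteq> 0})"
    using face_preserving_maps_support_deficiency[OF card, of w] by blast
  obtain P where P: "\<And>k. {i. w k p $ i \<noteq> 0} \<inter> P \<noteq> {}" "\<And>k. {i. w k p $ i \<noteq> 0} - P \<noteq> {}"
    using two_colouring_if_deficiency[of UNIV UNIV "\<lambda>k. {i. w k p $ i \<noteq> 0}"] * by auto
  have near: "h k i p > M k p - \<epsilon>" if "w k p $ i \<noteq> 0" for k i
    using that by (auto simp: w_def u_def max_def split: if_splits)
  have Q: "M k p - \<epsilon> < Max ((\<lambda>i. h k i p) ` Q) \<and> Max ((\<lambda>i. h k i p) ` Q) \<le> M k p"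
    if meets: "{i. w k p $ i \<noteq> 0} \<inter> Q \<noteq> {}" for k Q
  proof -
    obtain i where i: "i \<in> Q" "w k p $ i \<noteq> 0" using meets by auto
    have "h k i p \<le> Max ((\<lambda>i. h k i p) ` Q)" using i by simp
    moreover have "Max ((\<lambda>i. h k i p) ` Q) \<le> M k p"
      unfolding M_def using i by (intro Max_mono) auto
    ultimately show ?thesis using near[OF i(2)] by simp
  qed
  have "\<bar>Max ((\<lambda>i. h k i p) ` P) - Max ((\<lambda>i. h k i p) ` (- P))\<bar> < \<epsilon>" for k
    using Q[of k P] Q[of k "- P"] P[of k] by (auto simp: Diff_eq)
  \<comment> \<open>Any row will do: its support meets both colours.\<close>
  moreover have "P \<noteq> {}" "- P \<noteq> {}" using P[of undefined] by auto
  ultimately show ?thesis using p by blast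
qed

text \<open>Compactness: for each of the finitely many colourings the largest discrepancy over the
  rows attains its minimum on the simplex, and the least of these minima lies below every positive
  \<open>\<epsilon>\<close>.\<close>

lemma bichromatic_maxima:
  fixes h :: "'r::finite \<Rightarrow> 'c::finite \<Rightarrow> real ^ 'c \<Rightarrow> real"
  assumes card: "CARD('r) < CARD('c)"
    and cont: "\<And>k i. continuous_on std_simplex (h k i)"
    and nonneg: "\<And>k i p. p \<in> std_simplex \<Longrightarrow> 0 \<le> h k i p"
    and zero: "\<And>k i p. p \<in> std_simplex \<Longrightarrow> p $ i = 0 \<Longrightarrow> h k i p = 0"
  shows "\<exists>p\<in>std_simplex. \<exists>P. P \<noteq> {} \<and> - P \<noteq> {} \<and>
    (\<forall>k. Max ((\<lambda>i. h k i p) ` P) = Max ((\<lambda>i. h k i p) ` (- P)))"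
proof -
  define D where "D P p = Max ((\<lambda>k. \<bar>Max ((\<lambda>i. h k i p) ` P) - Max ((\<lambda>i. h k i p) ` (- P))\<bar>) ` UNIV)"
    for P p
  \<comment> \<open>Both colours are required to occur, so that \<open>Max\<close> never ranges over
    the empty set.\<close>
  define \<P> where "\<P> = {P :: 'c set. P \<noteq> {} \<and> - P \<noteq> {}}"
  have contD: "continuous_on std_simplex (D P)" if "P \<in> \<P>" for P
    using that unfolding D_def \<P>_def
    by (intro continuous_on_Max_image continuous_intros cont) auto
  have small: "\<exists>p\<in>std_simplex. \<exists>P\<in>\<P>. D P p < \<epsilon>" if "\<epsilon> > 0" for \<epsilon>
    using approx_bichromatic_maxima[OF card cont nonneg zero that] by (auto simp: D_def \<P>_def)
  have "std_simplex \<noteq> ({} :: (real ^ 'c) set)" "\<P> \<noteq> {}"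
    using small[of 1] by auto
  then have "\<forall>P\<in>\<P>. \<exists>p\<in>std_simplex. \<forall>q\<in>std_simplex. D P p \<le> D P q"
    using continuous_attains_inf[OF compact_std_simplex] contD by blast
  then obtain m where m: "\<And>P. P \<in> \<P> \<Longrightarrow> m P \<in> std_simplex"
    "\<And>P q. P \<in> \<P> \<Longrightarrow> q \<in> std_simplex \<Longrightarrow> D P (m P) \<le> D P q"
    by metis
  define \<mu> where "\<mu> = Min ((\<lambda>P. D P (m P)) ` \<P>)"
  have "\<mu> \<in> (\<lambda>P. D P (m P)) ` \<P>"
    unfolding \<mu>_def using \<open>\<P> \<noteq> {}\<close> by (intro Min_in) auto
  then obtain P where P: "P \<in> \<P>" "D P (m P) = \<mu>" by auto
  have "\<mu> \<le> 0"
  proof (rule ccontr)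
    assume "\<not> \<mu> \<le> 0"
    then obtain q Q where q: "q \<in> std_simplex" "Q \<in> \<P>" "D Q q < \<mu>" using small[of \<mu>] by auto
    have "\<mu> \<le> D Q (m Q)" unfolding \<mu>_def using q by (intro Min_le) auto
    with m(2)[OF q(2,1)] q(3) show False by simp
  qed
  have "Max ((\<lambda>i. h k i (m P)) ` P) = Max ((\<lambda>i. h k i (m P)) ` (- P))" for k
  proof -
    have "\<bar>Max ((\<lambda>i. h k i (m P)) ` P) - Max ((\<lambda>i. h k i (m P)) ` (- P))\<bar> \<le> D P (m P)"
      unfolding D_def by (rule Max_ge) auto
    with P(2) \<open>\<mu> \<le> 0\<close> show ?thesis by linarith
  qed
  with P(1) m(1)[OF P(1)] show ?thesis by (auto simp: \<P>_def)
qed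

section \<open>Max-T combinations and the partition of the points\<close>

text \<open>Convexity is a binary condition, so points are added one at a time. Keeping
  \<open>x j\<close>, whose coefficient is 1, in every partial maximum places that maximum in
  \<open>C\<close>; it then enters the next step with coefficient 1, which leaves it
  unchanged.\<close>

lemma max_T_convex_finite_combination:
  assumes T: "t_norm T" and C: "max_T_convex T C" and I: "finite I"
    and x: "\<And>i. i \<in> I \<Longrightarrow> x i \<in> C" and l: "\<And>i. i \<in> I \<Longrightarrow> l i \<in> {0..1}"
    and j: "j \<in> I" "l j = 1"
  shows "(\<chi> k. Max ((\<lambda>i. T (l i) (x i $ k)) ` I)) \<in> C"
proof -
  have scale1: "t_scale T 1 z = z" if "z \<in> C" for z
    using that T C
    by (auto simp: t_scale_def t_norm_def max_T_convex_def unit_cube_def vec_eq_iff subset_iff)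
  have "(\<chi> k. Max ((\<lambda>i. T (l i) (x i $ k)) ` insert j F)) \<in> C" if "finite F" "F \<subseteq> I" for F
    using that
  proof (induction F rule: finite_induct)
    case empty
    have "(\<chi> k. T (l j) (x j $ k)) = t_scale T 1 (x j)" by (simp add: t_scale_def j)
    then show ?case using scale1[OF x[OF j(1)]] x[OF j(1)] by simp
  next
    case (insert i F)
    let ?y = "\<chi> k. Max ((\<lambda>i. T (l i) (x i $ k)) ` insert j F)"
    have y: "?y \<in> C" using insert by simp
    have i: "x i \<in> C" "l i \<in> {0..1}" using x l insert.prems by auto
    then have "vmax (t_scale T 1 ?y) (t_scale T (l i) (x i)) \<in> C"
      using C y unfolding max_T_convex_def by (auto simp: max_def)
    moreover have "vmax (t_scale T 1 ?y) (t_scale T (l i) (x i))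
        = (\<chi> k. Max ((\<lambda>i. T (l i) (x i $ k)) ` insert j (insert i F)))"
      unfolding scale1[OF y] using insert.hyps
      by (simp add: vmax_def t_scale_def vec_eq_iff insert_commute[of j i] max.commute)
    ultimately show ?case by simp
  qed
  from this[of I] show ?thesis using I j by (simp add: insert_absorb)
qed

theorem theorem13:
  fixes T :: "real \<Rightarrow> real \<Rightarrow> real" and X :: "(real ^ 'd) set"
  assumes "continuous_t_norm T"
    and "X \<subseteq> unit_cube"
    and "card X = CARD('d) + 2"
  shows "\<exists>X1 X2. X1 \<subseteq> X \<and> X2 \<subseteq> X \<and> X1 \<inter> X2 = {} \<and>
           max_T_hull T X1 \<inter> max_T_hull T X2 \<noteq> {}"
proof -
  have T: "t_norm T" using assms(1) by (simp add: continuous_t_norm_def)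
  have "finite X" using assms(3) by (intro card_ge_0_finite) simp
  \<comment> \<open>The type \<open>'d option option\<close> supplies the \<open>d + 2\<close>
    columns.\<close>
  moreover have "card X = CARD('d option option)" using assms(3) by simp
  ultimately obtain x :: "'d option option \<Rightarrow> real ^ 'd" where x: "bij_betw x UNIV X"
    by (metis finite finite_same_card_bij)
  have xX: "x i \<in> X" for i using x by (auto simp: bij_betw_def)
  \<comment> \<open>The rows are indexed by \<open>'d option\<close>, with \<open>None\<close> for
    the extra coordinate.\<close>
  define a where "a k i = (case k of None \<Rightarrow> 1 | Some k' \<Rightarrow> x i $ k')" for k i
  have a: "a k i \<in> {0..1}" for k i
    using xX[of i] assms(2) by (auto simp: a_def unit_cube_def split: option.split)
  \<comment> \<open>As the entries of \<open>p\<close> sum to 1, some \<open>p $ j\<close> is at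
    least \<open>1 / c\<close>; scaling by \<open>c\<close> and truncating makes its coefficient
    exactly 1, while zero entries keep coefficient 0.\<close>
  define c where "c = real CARD('d option option)"
  have "c > 0" by (simp add: c_def)
  define l where "l p i = min 1 (c * p $ i)"
    for p :: "real ^ 'd option option" and i
  have l: "l p i \<in> {0..1}" if "p \<in> std_simplex" for p i
    using that \<open>c > 0\<close> by (simp add: l_def std_simplex_def)
  \<comment> \<open>Only the first argument varies; the fixed one enters the sequential definition
    as a constant sequence.\<close>
  have contT: "continuous_on {0..1} (\<lambda>s. T s b)" if "b \<in> {0..1}" for b
    unfolding continuous_on_sequentially
  proof (intro allI ballI impI, elim conjE)
    fix s c assume "c \<in> {0..1::real}" "\<forall>n. s n \<in> {0..1::real}" "s \<longlonglongrightarrow> c"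
    moreover have "\<forall>n::nat. b \<in> {0..1}" "(\<lambda>_. b) \<longlonglongrightarrow> b"
      using that by simp_all
    ultimately have "(\<lambda>n. T (s n) b) \<longlonglongrightarrow> T c b"
      using assms(1)[unfolded continuous_t_norm_def, THEN conjunct2, rule_format,
          of s "\<lambda>_. b" c b] by simp
    then show "((\<lambda>s. T s b) \<circ> s) \<longlonglongrightarrow> T c b" by (simp add: comp_def)
  qed
  define h where "h k i p = T (l p i) (a k i)" for k i and p :: "real ^ 'd option option"
  have h_cont: "continuous_on std_simplex (h k i)" for k i
    unfolding h_def
  proof (rule continuous_on_compose2[OF contT[OF a]])
    show "continuous_on std_simplex (\<lambda>p. l p i)"
      unfolding l_def by (intro continuous_intros)
  qed (use l in auto)
  have h_nonneg: "0 \<le> h k i p" if "p \<in> std_simplex" for k i p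
    using T l[OF that] a unfolding h_def t_norm_def by (meson atLeastAtMost_iff)
  \<comment> \<open>Monotonicity squeezes \<open>T 0 (a k i)\<close> between 0 and
    \<open>T 0 1 = 0\<close>.\<close>
  have h_zero: "h k i p = 0" if "p $ i = 0" for k i p
  proof -
    have "T 0 (a k i) \<in> {0..1}" "T 0 1 = 0"
      using T a[of k i] unfolding t_norm_def by simp_all
    moreover have "T 0 (a k i) \<le> T 0 1"
      using T a[of k i] unfolding t_norm_def by (metis atLeastAtMost_iff order_refl zero_le_one)
    ultimately show ?thesis by (simp add: h_def l_def that)
  qed
  have "CARD('d option) < CARD('d option option)" by simp
  from bichromatic_maxima[of h, OF this h_cont h_nonneg h_zero]
  obtain p P where p: "p \<in> std_simplex" and P: "P \<noteq> {}" "- P \<noteq> {}"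
    and eq: "\<And>k. Max ((\<lambda>i. h k i p) ` P) = Max ((\<lambda>i. h k i p) ` (- P))"
    by auto
  have h_None: "h None i p = l p i" for i
    using T l[OF p] by (simp add: h_def a_def t_norm_def)
  have "\<exists>j. l p j = 1"
  proof (rule ccontr)
    assume "\<not> ?thesis"
    then have "c * p $ j < 1" for j
      unfolding l_def by (metis linorder_not_le min.absorb1)
    then have "p $ j < 1 / c" for j
      using \<open>c > 0\<close> by (simp add: pos_less_divide_eq mult.commute)
    then have "(\<Sum>j\<in>UNIV. p $ j) < (\<Sum>j\<in>(UNIV :: 'd option option set). 1 / c)"
      by (intro sum_strict_mono) auto
    also have "\<dots> = 1" using \<open>c > 0\<close> by (simp add: c_def)
    finally show False using p by (simp add: std_simplex_def)
  qed
  then obtain j where j: "l p j = 1" ..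
  have Max_1: "Max ((\<lambda>i. l p i) ` Q) = 1" if "j \<in> Q" for Q
  proof (rule Max_eqI)
    show "1 \<in> (\<lambda>i. l p i) ` Q" using that j by force
  qed (use l[OF p] in auto)
  \<comment> \<open>Row \<open>None\<close> carries the coefficients themselves. The colour of
    \<open>j\<close> has maximum 1 there, and equality of the maxima passes this on to the other
    colour.\<close>
  have both: "Max ((\<lambda>i. l p i) ` P) = 1 \<and> Max ((\<lambda>i. l p i) ` (- P)) = 1"
    using eq[of None] Max_1[of P] Max_1[of "- P"] unfolding h_None by (cases "j \<in> P") auto
  define z where "z = (\<chi> k. Max ((\<lambda>i. T (l p i) (x i $ k)) ` P))"
  have in_hull: "(\<chi> k. Max ((\<lambda>i. T (l p i) (x i $ k)) ` Q)) \<in> max_T_hull T (x ` Q)"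
    if "Q \<noteq> {}" "Max ((\<lambda>i. l p i) ` Q) = 1" for Q
  proof -
    have "1 \<in> (\<lambda>i. l p i) ` Q" using Max_in[of "(\<lambda>i. l p i) ` Q"] that by simp
    then obtain i where i: "i \<in> Q" "l p i = 1" by auto
    have "x ` Q \<subseteq> unit_cube" using xX assms(2) by auto
    then have "max_T_convex T (max_T_hull T (x ` Q))" by (rule max_T_convex_max_T_hull[OF T])
    then show ?thesis
    proof (rule max_T_convex_finite_combination[OF T])
      show "x i \<in> max_T_hull T (x ` Q)" if "i \<in> Q" for i
        using that max_T_hull_superset by blast
    qed (use i l[OF p] in auto)
  qed
  \<comment> \<open>Row \<open>Some k\<close> says that both colours give the same coordinate
    \<open>k\<close>.\<close>
  have "z = (\<chi> k. Max ((\<lambda>i. T (l p i) (x i $ k)) ` (- P)))"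
    unfolding z_def vec_eq_iff
  proof
    fix k
    show "(\<chi> k. Max ((\<lambda>i. T (l p i) (x i $ k)) ` P)) $ k
        = (\<chi> k. Max ((\<lambda>i. T (l p i) (x i $ k)) ` (- P))) $ k"
      using eq[of "Some k"] by (simp add: h_def a_def)
  qed
  then have "z \<in> max_T_hull T (x ` P) \<inter> max_T_hull T (x ` (- P))"
    using in_hull[of P] in_hull[of "- P"] P both by (simp add: z_def)
  moreover have "x ` P \<inter> x ` (- P) = {}"
    using x by (auto simp: bij_betw_def inj_on_def)
  ultimately show ?thesis using xX
    by (intro exI[of _ "x ` P"] exI[of _ "x ` (- P)"]) auto
qed

end
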